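(* Let $V$ be the Volterra operator on $L^2[0,1]$, $Vf(t)=\int_0^t f(s)\,ds$. Then for every nonzero $f\in L^2[0,1]$, $k_f>0$. In other words, $0\notin\Lambda(V)$.
   Context: For quasinilpotent $T$ and $x\neq 0$, $k_x=k_x(T)=\limsup_{\lambda\to0}\frac{\ln\|(\lambda-T)^{-1}x\|}{\ln\|(\lambda-T)^{-1}\|}$, and $\Lambda(T)=\{k_x(T): x\neq0\}$. Here $T=V$. *)

theory Defs
  imports "HOL-Analysis.Analysis"
begin

text \<open>The Hilbert space L^2[0,1] (complex scalars), represented by complex-valued
functions on the reals, considered on [0,1] with Lebesgue measure; elements are
identified up to a.e. equality implicitly (all notions below are invariant).\<close>

abbreviation I01 :: "real measure" where
  "I01 \<equiv> lebesgue_on {0..1}"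

definition L2 :: "(real \<Rightarrow> complex) \<Rightarrow> bool" where
  "L2 f \<longleftrightarrow> f \<in> borel_measurable I01 \<and> integrable I01 (\<lambda>t. (cmod (f t))\<^sup>2)"

definition L2norm :: "(real \<Rightarrow> complex) \<Rightarrow> real" where
  "L2norm f = sqrt (\<integral>t. (cmod (f t))\<^sup>2 \<partial>I01)"

definition volterra :: "(real \<Rightarrow> complex) \<Rightarrow> (real \<Rightarrow> complex)" where
  "volterra f t = (LINT s:{0..t}|lebesgue. f s)"

text \<open>Resolvent applied to a vector: (\<lambda> - V)^{-1} x is the (a.e. unique, for \<lambda> \<noteq> 0)
L^2 solution g of \<lambda> g - V g = x.\<close>
definition resolvent_vec :: "complex \<Rightarrow> (real \<Rightarrow> complex) \<Rightarrow> (real \<Rightarrow> complex)" where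
  "resolvent_vec lam x = (SOME g. L2 g \<and> (AE t in I01. lam * g t - volterra g t = x t))"

definition resolvent_norm :: "complex \<Rightarrow> real" where
  "resolvent_norm lam = Sup {L2norm (resolvent_vec lam x) | x. L2 x \<and> L2norm x \<le> 1}"

definition k_vol :: "(real \<Rightarrow> complex) \<Rightarrow> ereal" where
  "k_vol x = Limsup (at (0::complex))
     (\<lambda>lam. ereal (ln (L2norm (resolvent_vec lam x)) / ln (resolvent_norm lam)))"

definition Lambda_vol :: "ereal set" where
  "Lambda_vol = {k_vol x | x. L2 x \<and> L2norm x \<noteq> 0}"

end

(* On real arguments lam = 1 / z the resolvent acts by z x + z^2 (e_z * x), where e_z * x is the
   convolution with exp (z t), and z (e_z * x) = V g for the resolvent vector g. Hence
   1 < ||R(1/z)|| <= exp (4 z) for large z, and ||R(1/z) f|| >= z |(e_z * f)(1)|. If k_f <= 0,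
   the integrals of exp (n (1 - s)) f(s) over [0,1] therefore grow subexponentially in n. By Mikusinski's
   argument with the kernel 1 - exp (- exp (n (t - s))) this forces the integral of f over [0,t]
   to vanish for all t < 1, so f = 0 almost everywhere. *)

theory Submission
  imports Defs "HOL-Real_Asymp.Real_Asymp"
begin

text \<open>A bound on a limsup over complex arguments tending to 0 can be tested along one
  sequence. The choice 1 / n lies on the positive axis, where the exponentials grow, and there the
  logarithm of the resolvent norm lies strictly between a positive lower bound and 4 n. The constant
  4 is crude, but k_f <= 0 gives a bound for every positive rate e, so any fixed constant is
  absorbed. The obstacle is that this yields information at the single endpoint 1 only. It suffices
  because the powers of exp (n (t - s)) factor as exp (- n k (1 - t)) exp (n k (1 - s)): moving the
  reference point from t to 1 gains a decaying factor that beats growth exp (e n k) as soon as e < 1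
  - t. This is why t < 1 is needed, and why integer samples are enough, since n k is again an
  integer.\<close>

definition exp_kernel :: "real \<Rightarrow> real \<Rightarrow> real \<Rightarrow> real" where
  "exp_kernel z t s = (if s \<le> t then exp (z * (t - s)) else 0)"

text \<open>Cutting the kernel off at s = t keeps the domain of integration fixed, which suits
  Fubini. The case z = 0 is the Volterra operator, so V and the convolutions in its resolvent belong
  to one family.\<close>

definition exp_conv :: "real \<Rightarrow> (real \<Rightarrow> complex) \<Rightarrow> (real \<Rightarrow> complex)" where
  "exp_conv z x t = (\<integral>s. exp_kernel z t s *\<^sub>R x s \<partial>I01)"

section \<open>Integrability and norm estimates on the unit interval\<close>

lemma finite_measure_I01: "finite_measure I01"
  by (rule finite_measure_lebesgue_on) simp

lemma measure_I01 [simp]: "measure I01 {0..1} = 1"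
  by (simp add: measure_restrict_space)

lemma measurable_ident_I01: "(\<lambda>s. s) \<in> borel_measurable I01"
  by (auto intro!: continuous_imp_measurable_on_sets_lebesgue continuous_intros)

lemma L2_measurable: "L2 x \<Longrightarrow> x \<in> borel_measurable I01"
  by (simp add: L2_def)

lemma borel_measurable_exp_kernel [measurable]:
  assumes [measurable]: "f \<in> borel_measurable M" "g \<in> borel_measurable M"
  shows "(\<lambda>w. exp_kernel z (f w) (g w)) \<in> borel_measurable M"
  unfolding exp_kernel_def by measurable

lemma exp_kernel_nonneg: "0 \<le> exp_kernel z t s"
  by (simp add: exp_kernel_def)

lemma exp_kernel_le:
  assumes "0 \<le> z" "t \<le> 1" "0 \<le> s"
  shows "exp_kernel z t s \<le> exp z"
  using assms mult_left_mono[of "t - s" 1 z] by (auto simp: exp_kernel_def)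

lemma L2_integrable:
  assumes "L2 x"
  shows "integrable I01 x"
proof (rule Bochner_Integration.integrable_bound)
  interpret finite_measure I01 by (rule finite_measure_I01)
  show "integrable I01 (\<lambda>t. 1 + (cmod (x t))\<^sup>2)"
    using assms by (simp add: L2_def)
  show "x \<in> borel_measurable I01" by (rule L2_measurable[OF assms])
  have "cmod (x t) \<le> 1 + (cmod (x t))\<^sup>2" for t
    using zero_le_power2[of "cmod (x t) - 1"] zero_le_power2[of "cmod (x t)"]
    unfolding power2_diff by (smt (verit) one_power2)
  then show "AE t in I01. norm (x t) \<le> norm (1 + (cmod (x t))\<^sup>2)" by simp
qed

text \<open>Cauchy-Schwarz against the constant 1 on a probability space, obtained as nonnegativity
  of the variance of |x|.\<close>

lemma integral_norm_le_L2norm: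
  assumes "L2 x"
  shows "(\<integral>t. cmod (x t) \<partial>I01) \<le> L2norm x"
proof -
  interpret finite_measure I01 by (rule finite_measure_I01)
  define m where "m = (\<integral>t. cmod (x t) \<partial>I01)"
  have i1: "integrable I01 (\<lambda>t. cmod (x t))" using L2_integrable[OF assms] by simp
  have i2: "integrable I01 (\<lambda>t. (cmod (x t))\<^sup>2)" using assms by (simp add: L2_def)
  have "0 \<le> (\<integral>t. (cmod (x t) - m)\<^sup>2 \<partial>I01)" by simp
  also have "\<dots> = (\<integral>t. (cmod (x t))\<^sup>2 - (2 * m) * cmod (x t) + m\<^sup>2 \<partial>I01)"
    by (simp add: power2_diff algebra_simps)
  also have "\<dots> = (\<integral>t. (cmod (x t))\<^sup>2 \<partial>I01) - 2 * m * m + m\<^sup>2"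
    using i1 i2 by (simp add: m_def)
  finally have "m\<^sup>2 \<le> (\<integral>t. (cmod (x t))\<^sup>2 \<partial>I01)" by (simp add: power2_eq_square)
  then have "m \<le> L2norm x" unfolding L2norm_def by (rule real_le_rsqrt)
  then show ?thesis by (simp add: m_def)
qed

lemma L2norm_nonneg [simp]: "0 \<le> L2norm x"
  by (simp add: L2norm_def)

lemma norm_add_square_le:
  fixes x y :: "'a::real_normed_vector"
  shows "(norm (x + y))\<^sup>2 \<le> 2 * (norm x)\<^sup>2 + 2 * (norm y)\<^sup>2"
proof -
  have "(norm (x + y))\<^sup>2 \<le> (norm x + norm y)\<^sup>2"
    by (simp add: norm_triangle_ineq power_mono)
  also have "\<dots> \<le> 2 * (norm x)\<^sup>2 + 2 * (norm y)\<^sup>2"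
    using zero_le_power2[of "norm x - norm y"]
    by (simp add: power2_eq_square algebra_simps)
  finally show ?thesis .
qed

text \<open>The squared estimate with factor 2 replaces the triangle inequality; the lost constant
  disappears in the later exponential bounds.\<close>

lemma L2_add:
  assumes "L2 x" "L2 y"
  shows "L2 (\<lambda>t. x t + y t)"
    and "(L2norm (\<lambda>t. x t + y t))\<^sup>2 \<le> 2 * (L2norm x)\<^sup>2 + 2 * (L2norm y)\<^sup>2"
proof -
  have [measurable]: "x \<in> borel_measurable I01" "y \<in> borel_measurable I01"
    using assms by (auto simp: L2_def)
  have i: "integrable I01 (\<lambda>t. (cmod (x t))\<^sup>2)" "integrable I01 (\<lambda>t. (cmod (y t))\<^sup>2)"
    using assms by (auto simp: L2_def)
  have ixy: "integrable I01 (\<lambda>t. (cmod (x t + y t))\<^sup>2)"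
  proof (rule Bochner_Integration.integrable_bound)
    show "integrable I01 (\<lambda>t. 2 * (cmod (x t))\<^sup>2 + 2 * (cmod (y t))\<^sup>2)"
      using i by simp
    show "AE t in I01. norm ((cmod (x t + y t))\<^sup>2) \<le> norm (2 * (cmod (x t))\<^sup>2 + 2 * (cmod (y t))\<^sup>2)"
      using norm_add_square_le by (intro AE_I2) simp
  qed measurable
  then show "L2 (\<lambda>t. x t + y t)" by (simp add: L2_def)
  have "(\<integral>t. (cmod (x t + y t))\<^sup>2 \<partial>I01) \<le> (\<integral>t. 2 * (cmod (x t))\<^sup>2 + 2 * (cmod (y t))\<^sup>2 \<partial>I01)"
    using i ixy by (intro integral_mono norm_add_square_le) auto
  then show "(L2norm (\<lambda>t. x t + y t))\<^sup>2 \<le> 2 * (L2norm x)\<^sup>2 + 2 * (L2norm y)\<^sup>2"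
    using i by (simp add: L2norm_def)
qed

lemma L2_scaleR:
  assumes "L2 x"
  shows "L2 (\<lambda>t. c *\<^sub>R x t)"
  using assms by (auto simp: L2_def power_mult_distrib intro: borel_measurable_scaleR)

lemma L2_bounded:
  assumes [measurable]: "x \<in> borel_measurable I01"
    and "0 \<le> B" "\<And>t. t \<in> {0..1} \<Longrightarrow> cmod (x t) \<le> B"
  shows "L2 x" "L2norm x \<le> B"
proof -
  interpret finite_measure I01 by (rule finite_measure_I01)
  have *: "AE t in I01. (cmod (x t))\<^sup>2 \<le> B\<^sup>2"
    using assms by (intro AE_I2) (auto intro: power_mono)
  have i: "integrable I01 (\<lambda>t. (cmod (x t))\<^sup>2)"
    by (rule integrable_const_bound[where B = "B\<^sup>2"]) (use * in auto)
  then show "L2 x" by (simp add: L2_def)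
  have "(\<integral>t. (cmod (x t))\<^sup>2 \<partial>I01) \<le> (\<integral>t. B\<^sup>2 \<partial>I01)"
    by (rule integral_mono_AE[OF i _ *]) simp
  then have "(\<integral>t. (cmod (x t))\<^sup>2 \<partial>I01) \<le> B\<^sup>2" by simp
  then show "L2norm x \<le> B" unfolding L2norm_def
    by (rule real_le_lsqrt[OF \<open>0 \<le> B\<close>])
qed

section \<open>Convolution with exponentials\<close>

lemma integrable_exp_kernel:
  fixes x :: "real \<Rightarrow> complex"
  assumes "integrable I01 x" "0 \<le> z" "t \<le> 1"
  shows "integrable I01 (\<lambda>s. exp_kernel z t s *\<^sub>R x s)"
proof (rule Bochner_Integration.integrable_bound)
  show "integrable I01 (\<lambda>s. exp z * cmod (x s))" using assms by simp
  note measurable_ident_I01 [measurable]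
  have [measurable]: "x \<in> borel_measurable I01" using assms by simp
  show "(\<lambda>s. exp_kernel z t s *\<^sub>R x s) \<in> borel_measurable I01" by measurable
  show "AE s in I01. norm (exp_kernel z t s *\<^sub>R x s) \<le> norm (exp z * cmod (x s))"
    using assms exp_kernel_le[OF assms(2,3)]
    by (intro AE_I2) (auto simp: exp_kernel_nonneg intro!: mult_right_mono)
qed

lemma norm_exp_conv_le:
  assumes "integrable I01 x" "0 \<le> z" "t \<le> 1"
  shows "cmod (exp_conv z x t) \<le> exp z * (\<integral>s. cmod (x s) \<partial>I01)"
proof -
  have "cmod (exp_conv z x t) \<le> (\<integral>s. exp z * cmod (x s) \<partial>I01)"
    unfolding exp_conv_def
    using assms exp_kernel_le[OF assms(2,3)] integrable_exp_kernel[OF assms]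
    by (intro Bochner_Integration.integral_norm_bound_integral)
      (auto simp: exp_kernel_nonneg intro!: mult_right_mono)
  then show ?thesis by simp
qed

lemma borel_measurable_exp_conv:
  assumes [measurable]: "x \<in> borel_measurable I01"
  shows "exp_conv z x \<in> borel_measurable I01"
proof -
  interpret finite_measure I01 by (rule finite_measure_I01)
  note measurable_ident_I01 [measurable]
  have "(\<lambda>t. \<integral>s. exp_kernel z t s *\<^sub>R x s \<partial>I01) \<in> borel_measurable I01"
    by measurable
  then show ?thesis by (simp add: exp_conv_def[abs_def])
qed

lemma volterra_eq_exp_conv:
  assumes "t \<in> {0..1}"
  shows "volterra x t = exp_conv 0 x t"
proof -
  have "exp_conv 0 x t = (\<integral>s. indicator {0..1} s *\<^sub>R (exp_kernel 0 t s *\<^sub>R x s) \<partial>lebesgue)"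
    unfolding exp_conv_def by (subst integral_restrict_space) auto
  also have "\<dots> = volterra x t"
    unfolding volterra_def set_lebesgue_integral_def using assms
    by (intro Bochner_Integration.integral_cong) (auto simp: exp_kernel_def split: split_indicator)
  finally show ?thesis by simp
qed

lemma integral_exp_I01:
  assumes "0 \<le> r" "t \<le> 1" "c \<noteq> 0"
  shows "(\<integral>s. indicator {r..t} s * exp (c * s) \<partial>I01) =
    (if r \<le> t then (exp (c * t) - exp (c * r)) / c else 0)"
proof -
  have "(\<integral>s. indicator {r..t} s * exp (c * s) \<partial>I01) =
      (\<integral>s. indicator {0..1} s *\<^sub>R (indicator {r..t} s * exp (c * s)) \<partial>lebesgue)"
    by (subst integral_restrict_space) auto
  also have "\<dots> = (\<integral>s. exp (c * s) * indicator {r..t} s \<partial>lebesgue)"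
    using assms by (intro Bochner_Integration.integral_cong) (auto split: split_indicator)
  also have "\<dots> = (\<integral>s. exp (c * s) * indicator {r..t} s \<partial>lborel)"
    by (rule integral_completion) measurable
  also have "\<dots> = (if r \<le> t then (exp (c * t) - exp (c * r)) / c else 0)"
  proof (cases "r \<le> t")
    case True
    have "(\<integral>s. exp (c * s) * indicator {r..t} s \<partial>lborel) = exp (c * t) / c - exp (c * r) / c"
    proof (rule integral_FTC_Icc_real[OF True])
      show "((\<lambda>s. exp (c * s) / c) has_real_derivative exp (c * s)) (at s)" for s
        using assms by (auto intro!: derivative_eq_intros)
    qed (auto intro!: continuous_intros)
    then show ?thesis using True by (simp add: diff_divide_distrib)
  qed simp
  finally show ?thesis .
qed

text \<open>The convolution of two exponentials is their divided difference, here in the form of a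
  resolvent identity. With one parameter equal to 0 it computes products of V with
  \<open>exp_conv z\<close>, in either order, which is all the operator algebra that the resolvent
  requires.\<close>

lemma exp_conv_exp_conv:
  assumes x: "integrable I01 x" and ab: "0 \<le> a" "0 \<le> b" "a \<noteq> b" and t: "t \<le> 1"
  shows "exp_conv a (exp_conv b x) t = (exp_conv a x t - exp_conv b x t) /\<^sub>R (a - b)"
proof -
  interpret finite_measure I01 by (rule finite_measure_I01)
  interpret P: pair_sigma_finite I01 I01 ..
  note measurable_ident_I01 [measurable]
  have [measurable]: "x \<in> borel_measurable I01" using x by simp
  let ?F = "\<lambda>r s. (exp_kernel a t s * exp_kernel b s r) *\<^sub>R x r"
  \<comment> \<open>The kernels are bounded on the square, so integrability of \<open>x\<close>
    alone justifies Fubini.\<close>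
  have bd: "exp_kernel a t s * exp_kernel b s r \<le> exp a * exp b"
    if "r \<in> {0..1}" "s \<in> {0..1}" for r s
    using that ab t by (intro mult_mono exp_kernel_le exp_kernel_nonneg) auto
  have "integrable (I01 \<Otimes>\<^sub>M I01) (case_prod ?F)"
  proof (rule P.Fubini_integrable)
    show "integrable I01 (\<lambda>r. \<integral>s. norm (case_prod ?F (r, s)) \<partial>I01)"
    proof (rule Bochner_Integration.integrable_bound)
      show "integrable I01 (\<lambda>r. exp a * exp b * cmod (x r))" using x by simp
      have "(\<integral>s. cmod (?F r s) \<partial>I01) \<le> exp a * exp b * cmod (x r)" if "r \<in> {0..1}" for r
      proof -
        have "(\<integral>s. cmod (?F r s) \<partial>I01) \<le> (\<integral>s. exp a * exp b * cmod (x r) \<partial>I01)"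
        proof (rule integral_mono_AE')
          show "AE s in I01. cmod (?F r s) \<le> exp a * exp b * cmod (x r)"
            using that bd by (intro AE_I2) (auto simp: exp_kernel_nonneg intro!: mult_right_mono)
        qed auto
        then show ?thesis by simp
      qed
      then show "AE r in I01. norm (\<integral>s. norm (case_prod ?F (r, s)) \<partial>I01) \<le> norm (exp a * exp b * cmod (x r))"
        by (intro AE_I2) (auto simp: abs_of_nonneg)
    qed measurable
    show "AE r in I01. integrable I01 (\<lambda>s. case_prod ?F (r, s))"
    proof (rule AE_I2)
      fix r :: real assume "r \<in> space I01"
      then show "integrable I01 (\<lambda>s. case_prod ?F (r, s))"
        by (intro integrable_const_bound[where B = "exp a * exp b * cmod (x r)"])
          (use bd in \<open>auto simp: exp_kernel_nonneg intro!: AE_I2 mult_right_mono\<close>)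
    qed
  qed measurable
  then have swap: "(\<integral>s. (\<integral>r. ?F r s \<partial>I01) \<partial>I01) = (\<integral>r. (\<integral>s. ?F r s \<partial>I01) \<partial>I01)"
    by (rule P.Fubini_integral)
  \<comment> \<open>The product of the kernels lives on r <= s <= t, where it is a constant in s
    times exp ((b - a) s); a \<noteq> b makes that exponential integrate to a quotient.\<close>
  have inner: "(\<integral>s. exp_kernel a t s * exp_kernel b s r \<partial>I01) =
      (exp_kernel a t r - exp_kernel b t r) / (a - b)" if "r \<in> {0..1}" for r
  proof -
    have "(\<integral>s. exp_kernel a t s * exp_kernel b s r \<partial>I01) =
        (\<integral>s. exp (a * t - b * r) * (indicator {r..t} s * exp ((b - a) * s)) \<partial>I01)"
      by (intro Bochner_Integration.integral_cong)
        (auto simp: exp_kernel_def algebra_simps simp flip: exp_add split: split_indicator)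
    also have "\<dots> = exp (a * t - b * r) *
        (if r \<le> t then (exp ((b - a) * t) - exp ((b - a) * r)) / (b - a) else 0)"
      using that t ab by (subst integral_mult_right_zero, subst integral_exp_I01) auto
    also have "\<dots> = (exp_kernel a t r - exp_kernel b t r) / (a - b)"
    proof -
      have "exp (a * t - b * r) * (exp ((b - a) * t) - exp ((b - a) * r)) =
          exp (b * (t - r)) - exp (a * (t - r))"
        by (simp add: algebra_simps flip: exp_add)
      then have "exp (a * t - b * r) * ((exp ((b - a) * t) - exp ((b - a) * r)) / (b - a)) =
          (exp (a * (t - r)) - exp (b * (t - r))) / (a - b)"
        by (metis minus_diff_eq minus_divide_divide times_divide_eq_right)
      then show ?thesis by (auto simp: exp_kernel_def)
    qed
    finally show ?thesis .
  qed
  have "exp_conv a (exp_conv b x) t = (\<integral>s. (\<integral>r. ?F r s \<partial>I01) \<partial>I01)"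
    unfolding exp_conv_def by (simp flip: integral_scaleR_right)
  also have "\<dots> = (\<integral>r. (exp_kernel a t r *\<^sub>R x r - exp_kernel b t r *\<^sub>R x r) /\<^sub>R (a - b) \<partial>I01)"
    unfolding swap
  proof (rule Bochner_Integration.integral_cong)
    fix r :: real assume "r \<in> space I01"
    then have "r \<in> {0..1}" by simp
    have "integrable I01 (\<lambda>s. exp_kernel a t s * exp_kernel b s r)"
      by (rule integrable_const_bound[where B = "exp a * exp b"])
        (use bd \<open>r \<in> {0..1}\<close> in \<open>auto simp: exp_kernel_nonneg intro!: AE_I2\<close>)
    then have "(\<integral>s. ?F r s \<partial>I01) = (\<integral>s. exp_kernel a t s * exp_kernel b s r \<partial>I01) *\<^sub>R x r"
      by simp
    then show "(\<integral>s. ?F r s \<partial>I01) = (exp_kernel a t r *\<^sub>R x r - exp_kernel b t r *\<^sub>R x r) /\<^sub>R (a - b)"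
      unfolding inner[OF \<open>r \<in> {0..1}\<close>] by (simp add: divide_inverse algebra_simps)
  qed simp
  also have "\<dots> = (exp_conv a x t - exp_conv b x t) /\<^sub>R (a - b)"
    unfolding exp_conv_def using x ab t integrable_exp_kernel by simp
  finally show ?thesis .
qed

lemma L2norm_scaleR: "L2norm (\<lambda>t. c *\<^sub>R x t) = \<bar>c\<bar> * L2norm x"
  by (simp add: L2norm_def power_mult_distrib real_sqrt_mult)

lemma L2norm_cong_AE:
  assumes "x \<in> borel_measurable I01" "y \<in> borel_measurable I01" "AE t in I01. x t = y t"
  shows "L2norm x = L2norm y"
proof -
  have "(\<integral>t. (cmod (x t))\<^sup>2 \<partial>I01) = (\<integral>t. (cmod (y t))\<^sup>2 \<partial>I01)"
    using assms by (intro integral_cong_AE) auto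
  then show ?thesis by (simp add: L2norm_def)
qed

lemma L2_exp_conv:
  assumes "L2 x" "0 \<le> z"
  shows "L2 (exp_conv z x)" "L2norm (exp_conv z x) \<le> exp z * L2norm x"
proof -
  have "cmod (exp_conv z x t) \<le> exp z * L2norm x" if "t \<in> {0..1}" for t
  proof -
    have "cmod (exp_conv z x t) \<le> exp z * (\<integral>s. cmod (x s) \<partial>I01)"
      using that assms by (intro norm_exp_conv_le L2_integrable) auto
    also have "\<dots> \<le> exp z * L2norm x"
      using integral_norm_le_L2norm[OF assms(1)] by simp
    finally show ?thesis .
  qed
  then show "L2 (exp_conv z x)" "L2norm (exp_conv z x) \<le> exp z * L2norm x"
    using borel_measurable_exp_conv[OF L2_measurable[OF assms(1)]]
      L2_bounded[of "exp_conv z x" "exp z * L2norm x"] by auto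
qed

lemma exp_conv_cong_AE:
  assumes [measurable]: "x \<in> borel_measurable I01" "y \<in> borel_measurable I01"
    and "AE s in I01. x s = y s"
  shows "exp_conv z x t = exp_conv z y t"
  unfolding exp_conv_def
proof (rule integral_cong_AE)
  note measurable_ident_I01 [measurable]
  show "(\<lambda>s. exp_kernel z t s *\<^sub>R x s) \<in> borel_measurable I01" by measurable
  show "(\<lambda>s. exp_kernel z t s *\<^sub>R y s) \<in> borel_measurable I01" by measurable
qed (use assms(3) in eventually_elim, simp)

lemma exp_conv_lincomb:
  assumes "integrable I01 x" "integrable I01 y" "0 \<le> z" "t \<le> 1"
  shows "exp_conv z (\<lambda>s. p *\<^sub>R x s + q *\<^sub>R y s) t = p *\<^sub>R exp_conv z x t + q *\<^sub>R exp_conv z y t"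
proof -
  have "exp_conv z (\<lambda>s. p *\<^sub>R x s + q *\<^sub>R y s) t =
      (\<integral>s. p *\<^sub>R (exp_kernel z t s *\<^sub>R x s) + q *\<^sub>R (exp_kernel z t s *\<^sub>R y s) \<partial>I01)"
    unfolding exp_conv_def by (simp add: algebra_simps)
  also have "\<dots> = p *\<^sub>R exp_conv z x t + q *\<^sub>R exp_conv z y t"
    unfolding exp_conv_def using assms by (simp add: integrable_exp_kernel del: scaleR_scaleR)
  finally show ?thesis .
qed

section \<open>The resolvent of V at positive real points\<close>

text \<open>The formula for \<open>g\<close> is the Neumann series, the sum of z^(k+1) V^k x,
  resummed: the iterated kernels (t - s)^(k-1) / (k-1)! add up to an exponential. The check only
  needs V g = z (e_z * x), from the convolution identity with parameters 0 and z.\<close>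

lemma resolvent_vec_exists:
  assumes x: "L2 x" and z: "0 < z"
  defines "g \<equiv> \<lambda>t. z *\<^sub>R x t + z\<^sup>2 *\<^sub>R exp_conv z x t"
  shows "L2 g" "AE t in I01. complex_of_real (1 / z) * g t - volterra g t = x t"
proof -
  have K: "L2 (exp_conv z x)" using x z by (simp add: L2_exp_conv)
  show "L2 g" unfolding g_def by (intro L2_add L2_scaleR x K)
  show "AE t in I01. complex_of_real (1 / z) * g t - volterra g t = x t"
  proof (rule AE_I2)
    fix t :: real assume "t \<in> space I01"
    then have t: "t \<in> {0..1}" by simp
    have "volterra g t = z *\<^sub>R exp_conv 0 x t + z\<^sup>2 *\<^sub>R exp_conv 0 (exp_conv z x) t"
      unfolding volterra_eq_exp_conv[OF t] g_def
      using t x K by (intro exp_conv_lincomb L2_integrable) auto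
    also have "\<dots> = z *\<^sub>R exp_conv z x t"
      using t z by (simp add: exp_conv_exp_conv[OF L2_integrable[OF x]] power2_eq_square algebra_simps)
    finally show "complex_of_real (1 / z) * g t - volterra g t = x t"
      using z by (simp add: g_def scaleR_conv_of_real power2_eq_square field_simps)
  qed
qed

text \<open>Convolving g = z x + z V g with exp (z t) turns the last term into (e_z * g) - V g; then
  e_z * g cancels and V g is determined. This covers every L2 solution, so the arbitrary choice in
  \<open>resolvent_vec\<close> does no harm. The first claim is pointwise, since convolutions ignore
  null sets, so the value at t = 1 is meaningful.\<close>

lemma resolvent_equation_solution:
  assumes x: "L2 x" and z: "0 < z" and g: "L2 g"
    and eq: "AE t in I01. complex_of_real (1 / z) * g t - volterra g t = x t"
  shows "\<And>t. t \<le> 1 \<Longrightarrow> exp_conv 0 g t = z *\<^sub>R exp_conv z x t"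
    and "AE t in I01. g t = z *\<^sub>R x t + z\<^sup>2 *\<^sub>R exp_conv z x t"
proof -
  have V: "L2 (exp_conv 0 g)" using g by (simp add: L2_exp_conv)
  have "AE t in I01. t \<in> space I01" by (rule AE_space)
  with eq have g_eq: "AE t in I01. g t = z *\<^sub>R x t + z *\<^sub>R exp_conv 0 g t"
  proof eventually_elim
    case (elim t)
    then show ?case using z
      by (simp add: volterra_eq_exp_conv scaleR_conv_of_real field_simps)
  qed
  have *: "exp_conv 0 g t = z *\<^sub>R exp_conv z x t" if "t \<le> 1" for t
  proof -
    have "exp_conv z g t = exp_conv z (\<lambda>t. z *\<^sub>R x t + z *\<^sub>R exp_conv 0 g t) t"
      using x g V g_eq by (intro exp_conv_cong_AE L2_measurable L2_add L2_scaleR)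
    also have "\<dots> = z *\<^sub>R exp_conv z x t + z *\<^sub>R exp_conv z (exp_conv 0 g) t"
      using that x V z by (intro exp_conv_lincomb L2_integrable) auto
    also have "exp_conv z (exp_conv 0 g) t = (exp_conv z g t - exp_conv 0 g t) /\<^sub>R (z - 0)"
      using that z by (intro exp_conv_exp_conv L2_integrable g) auto
    finally show ?thesis using z by simp
  qed
  then show "\<And>t. t \<le> 1 \<Longrightarrow> exp_conv 0 g t = z *\<^sub>R exp_conv z x t" .
  from g_eq \<open>AE t in I01. t \<in> space I01\<close>
  show "AE t in I01. g t = z *\<^sub>R x t + z\<^sup>2 *\<^sub>R exp_conv z x t"
    by eventually_elim (use * in \<open>simp add: power2_eq_square\<close>)
qed

lemma resolvent_vec_spec:
  assumes "L2 x" "0 < z"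
  shows "L2 (resolvent_vec (complex_of_real (1 / z)) x)"
    and "AE t in I01. complex_of_real (1 / z) * resolvent_vec (complex_of_real (1 / z)) x t -
      volterra (resolvent_vec (complex_of_real (1 / z)) x) t = x t"
  using someI_ex[of "\<lambda>g. L2 g \<and> (AE t in I01. complex_of_real (1 / z) * g t - volterra g t = x t)"]
    resolvent_vec_exists[OF assms] unfolding resolvent_vec_def by blast+

text \<open>Evaluating V g at 1 is integrating g over [0,1], a functional of norm at most 1 on
  L2.\<close>

lemma L2norm_resolvent_vec_ge:
  assumes "L2 x" "0 < z"
  shows "z * cmod (exp_conv z x 1) \<le> L2norm (resolvent_vec (complex_of_real (1 / z)) x)"
proof -
  let ?g = "resolvent_vec (complex_of_real (1 / z)) x"
  have g: "L2 ?g" by (rule resolvent_vec_spec[OF assms])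
  have "z * cmod (exp_conv z x 1) = cmod (exp_conv 0 ?g 1)"
    using resolvent_equation_solution(1)[OF assms resolvent_vec_spec[OF assms], of 1] assms
    by simp
  also have "\<dots> \<le> exp 0 * (\<integral>s. cmod (?g s) \<partial>I01)"
    by (rule norm_exp_conv_le[OF L2_integrable[OF g]]) auto
  also have "\<dots> \<le> L2norm ?g" using integral_norm_le_L2norm[OF g] by simp
  finally show ?thesis .
qed

lemma L2norm_resolvent_vec_le:
  assumes "L2 x" "L2norm x \<le> 1" "1 \<le> z"
  shows "L2norm (resolvent_vec (complex_of_real (1 / z)) x) \<le> exp (4 * z)"
proof -
  have z: "0 < z" using assms by simp
  let ?g = "resolvent_vec (complex_of_real (1 / z)) x"
  let ?h = "\<lambda>t. z *\<^sub>R x t + z\<^sup>2 *\<^sub>R exp_conv z x t"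
  note g = resolvent_vec_spec[OF assms(1) z]
  have "L2norm ?g = L2norm ?h"
    using resolvent_equation_solution(2)[OF assms(1) z g] resolvent_vec_exists(1)[OF assms(1) z] g(1)
    by (intro L2norm_cong_AE L2_measurable)
  then have "(L2norm ?g)\<^sup>2 \<le> 2 * (L2norm (\<lambda>t. z *\<^sub>R x t))\<^sup>2 + 2 * (L2norm (\<lambda>t. z\<^sup>2 *\<^sub>R exp_conv z x t))\<^sup>2"
    using L2_add(2)[OF L2_scaleR[OF assms(1)] L2_scaleR[OF L2_exp_conv(1)[OF assms(1)]], of z z "z\<^sup>2"] z
    by simp
  \<comment> \<open>The prefactor \<open>z\<^sup>2\<close> costs exp (2 z) and the convolution costs
    exp z. A last factor exp z absorbs the numerical constant, which gives the exponent 4 z.\<close>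
  also have "\<dots> \<le> 2 * (exp (3 * z))\<^sup>2 + 2 * (exp (3 * z))\<^sup>2"
  proof -
    have z_le: "z \<le> exp z" using exp_ge_add_one_self[of z] by linarith
    have "L2norm (\<lambda>t. z *\<^sub>R x t) \<le> exp z * 1"
      unfolding L2norm_scaleR using assms z z_le by (intro mult_mono) auto
    also have "\<dots> \<le> exp (3 * z)" using z by simp
    finally have 1: "L2norm (\<lambda>t. z *\<^sub>R x t) \<le> exp (3 * z)" .
    have "L2norm (exp_conv z x) \<le> exp z * 1"
      by (rule order_trans[OF L2_exp_conv(2)[OF assms(1)]]) (use assms z in auto)
    then have "L2norm (\<lambda>t. z\<^sup>2 *\<^sub>R exp_conv z x t) \<le> (exp z)\<^sup>2 * (exp z * 1)"
      unfolding L2norm_scaleR using z z_le by (intro mult_mono) (auto intro: power_mono)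
    also have "\<dots> = exp (3 * z)"
      by (simp add: power2_eq_square flip: exp_add)
    finally have 2: "L2norm (\<lambda>t. z\<^sup>2 *\<^sub>R exp_conv z x t) \<le> exp (3 * z)" .
    show ?thesis using power_mono[OF 1 L2norm_nonneg, of 2] power_mono[OF 2 L2norm_nonneg, of 2] by linarith
  qed
  also have "\<dots> \<le> (exp z)\<^sup>2 * (exp (3 * z))\<^sup>2"
  proof -
    have "2 \<le> exp z" using exp_ge_add_one_self[of z] assms by linarith
    then have "2\<^sup>2 \<le> (exp z)\<^sup>2" by (rule power_mono) simp
    then have "2\<^sup>2 * (exp (3 * z))\<^sup>2 \<le> (exp z)\<^sup>2 * (exp (3 * z))\<^sup>2"
      by (rule mult_right_mono) simp
    then show ?thesis by simp
  qed
  also have "\<dots> = (exp (4 * z))\<^sup>2"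
    by (simp flip: exp_add power_mult_distrib)
  finally show ?thesis by (rule power2_le_imp_le) simp
qed

text \<open>The strict lower bound makes the logarithm in the denominator of \<open>k_vol\<close>
  positive; it is tested on the constant function 1, with exp z - 1 >= z >= 2. The uniform upper
  bound also makes the supremum a genuine one.\<close>

lemma resolvent_norm_bounds:
  assumes "2 \<le> z"
  shows "1 < resolvent_norm (complex_of_real (1 / z))"
    and "resolvent_norm (complex_of_real (1 / z)) \<le> exp (4 * z)"
proof -
  let ?lam = "complex_of_real (1 / z)"
  let ?S = "{L2norm (resolvent_vec ?lam x) | x. L2 x \<and> L2norm x \<le> 1}"
  have one: "L2 (\<lambda>_. 1)" "L2norm (\<lambda>_. 1) \<le> 1"
    using L2_bounded[of "\<lambda>_. 1" 1] by auto
  have le: "y \<le> exp (4 * z)" if "y \<in> ?S" for y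
    using that L2norm_resolvent_vec_le assms by auto
  have mem: "L2norm (resolvent_vec ?lam (\<lambda>_. 1)) \<in> ?S" using one by blast
  show "resolvent_norm ?lam \<le> exp (4 * z)"
    unfolding resolvent_norm_def by (rule cSup_least) (use mem le in auto)
  have "exp_conv z (\<lambda>_. 1) 1 = complex_of_real (\<integral>s. exp_kernel z 1 s \<partial>I01)"
    unfolding exp_conv_def by (simp add: scaleR_conv_of_real)
  also have "(\<integral>s. exp_kernel z 1 s \<partial>I01) =
      (\<integral>s. exp z * (indicator {0..1} s * exp ((- z) * s)) \<partial>I01)"
    by (intro Bochner_Integration.integral_cong)
      (auto simp: exp_kernel_def algebra_simps simp flip: exp_add)
  also have "\<dots> = exp z * ((exp (- z * 1) - exp (- z * 0)) / (- z))"
    using assms by (subst integral_mult_right_zero, subst integral_exp_I01) auto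
  also have "\<dots> = (exp z - 1) / z"
    using assms by (simp add: field_simps exp_minus)
  finally have "z * cmod (exp_conv z (\<lambda>_. 1) 1) = exp z - 1"
    using assms by (simp only: norm_of_real) simp
  moreover have "1 < exp z - 1" using exp_ge_add_one_self[of z] assms by linarith
  ultimately have "1 < L2norm (resolvent_vec ?lam (\<lambda>_. 1))"
    using L2norm_resolvent_vec_ge[OF one(1), of z] assms by linarith
  also have "\<dots> \<le> resolvent_norm ?lam"
    unfolding resolvent_norm_def by (rule cSup_upper[OF mem bdd_aboveI[OF le]])
  finally show "1 < resolvent_norm ?lam" .
qed

section \<open>Subexponential growth of the endpoint integrals\<close>

lemma eventually_norm_exp_conv_le:
  assumes f: "L2 f" and k: "k_vol f \<le> 0" and e: "0 < e"
  shows "\<forall>\<^sub>F n in sequentially. cmod (exp_conv (real n) f 1) \<le> exp (e * real n)"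
proof -
  let ?lam = "\<lambda>n. complex_of_real (1 / real n)"
  \<comment> \<open>The rate e / 4 compensates the 4 in the bound exp (4 n) for the resolvent
    norm.\<close>
  have "Limsup (at 0) (\<lambda>lam. ereal (ln (L2norm (resolvent_vec lam f)) / ln (resolvent_norm lam))) < ereal (e / 4)"
    using k e unfolding k_vol_def by (metis divide_pos_pos ereal_less(2) order_le_less_trans zero_less_numeral)
  from Limsup_lessD[OF this]
  have ev: "\<forall>\<^sub>F lam in at 0. ln (L2norm (resolvent_vec lam f)) / ln (resolvent_norm lam) < e / 4"
    by simp
  have "(\<lambda>n. 1 / real n) \<longlonglongrightarrow> 0" by (rule lim_1_over_n)
  then have "?lam \<longlonglongrightarrow> complex_of_real 0" by (rule tendsto_of_real)
  \<comment> \<open>The punctured filter requires nonzero points; n = 0 is excluded because 1 / 0 =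
    0.\<close>
  then have "filterlim ?lam (at 0) sequentially"
    by (auto simp: filterlim_at intro!: eventually_sequentiallyI[of 1])
  with ev have "\<forall>\<^sub>F n in sequentially. ln (L2norm (resolvent_vec (?lam n) f)) / ln (resolvent_norm (?lam n)) < e / 4"
    by (rule eventually_compose_filterlim)
  moreover have "\<forall>\<^sub>F n :: nat in sequentially. 2 \<le> n" by (rule eventually_ge_at_top)
  ultimately show ?thesis
  proof eventually_elim
    case (elim n)
    then have n: "2 \<le> real n" by simp
    let ?g = "resolvent_vec (?lam n) f"
    note R = resolvent_norm_bounds[OF n]
    have "L2norm ?g \<le> exp (e * real n)"
    \<comment> \<open>Passing back from \<open>ln\<close> to the norm requires positivity; a zero
      norm satisfies the bound trivially.\<close>
    proof (cases "L2norm ?g = 0")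
      case False
      then have pos: "0 < L2norm ?g" using L2norm_nonneg[of ?g] by linarith
      have "ln (L2norm ?g) \<le> e / 4 * ln (resolvent_norm (?lam n))"
        using elim R(1) ln_gt_zero[OF R(1)] by (simp add: divide_less_eq)
      also have "\<dots> \<le> e / 4 * (4 * real n)"
        using R e ln_le_cancel_iff[of "resolvent_norm (?lam n)" "exp (4 * real n)"]
        by (intro mult_left_mono) auto
      finally have "ln (L2norm ?g) \<le> e * real n" by simp
      then show ?thesis using pos by (metis exp_le_cancel_iff exp_ln)
    qed simp
    moreover have "real n * cmod (exp_conv (real n) f 1) \<le> L2norm ?g"
      using n by (intro L2norm_resolvent_vec_ge f) auto
    moreover have "1 * cmod (exp_conv (real n) f 1) \<le> real n * cmod (exp_conv (real n) f 1)"
      using n by (intro mult_right_mono) auto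
    ultimately show ?case by simp
  qed
qed

section \<open>Vanishing primitives force a vanishing function\<close>

lemma AE_I01_neq: "AE s in I01. s \<noteq> c"
  using AE_lborel_singleton[of c]
  by (auto simp: AE_restrict_space_iff AE_completion_iff elim: eventually_mono)

text \<open>The Borel sets over which \<open>f\<close> integrates to 0 form a Dynkin system
  containing the half-lines, which are stable under intersection and generate the Borel sets. Null
  sets then extend this to all Lebesgue sets.\<close>

lemma AE_zero_if_exp_conv_zero:
  assumes f: "integrable I01 f" and 0: "\<And>t. t < 1 \<Longrightarrow> exp_conv 0 f t = 0"
  shows "AE s in I01. f s = 0"
proof -
  interpret finite_measure I01 by (rule finite_measure_I01)
  note measurable_ident_I01 [measurable]
  have [measurable]: "f \<in> borel_measurable I01" using f by simp
  have ker: "exp_kernel 0 t s = indicator {..t} s" for t s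
    by (simp add: exp_kernel_def)
  have borel_sets: "A \<inter> {0..1} \<in> sets I01" if "A \<in> sets borel" for A
    using that by (auto simp: sets_restrict_space)
  have int_ind: "integrable I01 (\<lambda>s. indicator A s *\<^sub>R f s)" if "A \<in> sets borel" for A
  proof -
    have "integrable I01 (\<lambda>s. indicator (A \<inter> {0..1}) s *\<^sub>R f s)"
      by (rule integrable_mult_indicator[OF borel_sets[OF that] f])
    then show ?thesis
      by (rule Bochner_Integration.integrable_cong[THEN iffD1, rotated -1]) (auto split: split_indicator)
  qed
  have half: "(\<integral>s. indicator {..t} s *\<^sub>R f s \<partial>I01) = 0" if "t < 1" for t
    using 0[OF that] by (simp add: exp_conv_def ker)
  \<comment> \<open>The endpoint 1 lies outside the hypothesis and is reached as a limit from below,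
    the point 1 being null. Complements need this total integral.\<close>
  have total: "(\<integral>s. f s \<partial>I01) = 0"
  proof -
    let ?t = "\<lambda>n. 1 - 1 / real (Suc n)"
    have "(\<lambda>n. \<integral>s. indicator {..?t n} s *\<^sub>R f s \<partial>I01) \<longlonglongrightarrow> (\<integral>s. f s \<partial>I01)"
    proof (rule integral_dominated_convergence)
      show "integrable I01 (\<lambda>s. cmod (f s))" using f by simp
      show "(\<lambda>s. indicator {..?t n} s *\<^sub>R f s) \<in> borel_measurable I01" for n
        by (rule borel_measurable_integrable[OF int_ind]) simp
      show "AE s in I01. norm (indicator {..?t n} s *\<^sub>R f s) \<le> cmod (f s)" for n
        by (intro AE_I2) (auto split: split_indicator)
      have lim: "?t \<longlonglongrightarrow> 1 - 0"
        by (intro tendsto_diff tendsto_const lim_1_over_n[THEN LIMSEQ_Suc])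
      have "AE s in I01. s \<in> space I01" by (rule AE_space)
      with AE_I01_neq[of 1] show "AE s in I01. (\<lambda>n. indicator {..?t n} s *\<^sub>R f s) \<longlonglongrightarrow> f s"
      proof eventually_elim
        case (elim s)
        then have "s < 1 - 0" by simp
        from order_tendstoD(1)[OF lim this] show ?case
          by (intro tendsto_eventually) (auto elim!: eventually_mono)
      qed
    qed simp
    moreover have "(\<integral>s. indicator {..?t n} s *\<^sub>R f s \<partial>I01) = 0" for n
      by (rule half) simp
    ultimately show ?thesis by (simp add: LIMSEQ_const_iff)
  qed
  have borel: "(\<integral>s. indicator A s *\<^sub>R f s \<partial>I01) = 0" if "A \<in> sets borel" for A
  proof -
    have sig: "sigma_sets UNIV (range (\<lambda>a::real. {..a})) = sets borel"
      by (simp add: borel_eq_atMost)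
    have "Int_stable (range (\<lambda>a::real. {..a}))"
      by (auto simp: Int_stable_def)
    then show ?thesis
    proof (rule sigma_sets_induct_disjoint[of _ UNIV A])
      show "A \<in> sigma_sets UNIV (range (\<lambda>a::real. {..a}))" using that sig by simp
    next
      fix A assume "A \<in> range (\<lambda>a::real. {..a})"
      then obtain a where A: "A = {..a}" by auto
      show "(\<integral>s. indicator A s *\<^sub>R f s \<partial>I01) = 0"
      proof (cases "a < 1")
        case True
        then show ?thesis by (simp add: A half)
      next
        case False
        have "(\<integral>s. indicator A s *\<^sub>R f s \<partial>I01) = (\<integral>s. f s \<partial>I01)"
          using False by (intro Bochner_Integration.integral_cong) (auto simp: A)
        then show ?thesis by (simp add: total)
      qed
    next
      fix A assume A: "A \<in> sigma_sets UNIV (range (\<lambda>a::real. {..a}))"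
        and IH: "(\<integral>s. indicator A s *\<^sub>R f s \<partial>I01) = 0"
      have "(\<integral>s. indicator (UNIV - A) s *\<^sub>R f s \<partial>I01) = (\<integral>s. f s - indicator A s *\<^sub>R f s \<partial>I01)"
        by (intro Bochner_Integration.integral_cong) (auto split: split_indicator)
      also have "\<dots> = 0"
        using f int_ind[of A] A by (simp add: sig total IH)
      finally show "(\<integral>s. indicator (UNIV - A) s *\<^sub>R f s \<partial>I01) = 0" .
    next
      fix A :: "nat \<Rightarrow> real set"
      assume dj: "disjoint_family A" and A: "range A \<subseteq> sigma_sets UNIV (range (\<lambda>a::real. {..a}))"
        and IH: "\<And>i. (\<integral>s. indicator (A i) s *\<^sub>R f s \<partial>I01) = 0"
      \<comment> \<open>Countable additivity is applied in \<open>I01\<close>, whose measurable sets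
        lie inside [0,1].\<close>
      let ?B = "\<lambda>i. A i \<inter> {0..1}"
      have A': "A i \<in> sets borel" for i using A sig by auto
      have cong: "(\<integral>s. indicator (S \<inter> {0..1}) s *\<^sub>R f s \<partial>I01) = (\<integral>s. indicator S s *\<^sub>R f s \<partial>I01)" for S
        by (intro Bochner_Integration.integral_cong) (auto split: split_indicator)
      have "(LINT s:(\<Union>i. ?B i)|I01. f s) = (\<Sum>i. (LINT s:?B i|I01. f s))"
      proof (rule lebesgue_integral_countable_add)
        show "?B i \<in> sets I01" for i using A' by (rule borel_sets)
        then have "(\<Union>i. ?B i) \<in> sets I01" by (intro sets.countable_UN) auto
        then show "set_integrable I01 (\<Union>i. ?B i) f"
          unfolding set_integrable_def by (rule integrable_mult_indicator[OF _ f])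
      qed (use dj in \<open>auto simp: disjoint_family_on_def\<close>)
      also have "\<dots> = 0"
        by (simp add: set_lebesgue_integral_def cong IH)
      also have "(\<Union>i. ?B i) = (\<Union>i. A i) \<inter> {0..1}" by auto
      finally show "(\<integral>s. indicator (\<Union>i. A i) s *\<^sub>R f s \<partial>I01) = 0"
        by (simp add: set_lebesgue_integral_def cong)
    qed auto
  qed
  show ?thesis
  proof (rule density_zero[OF f])
    fix A assume A: "A \<in> sets I01"
    then have "A \<in> sets lebesgue" by (auto simp: sets_restrict_space)
    \<comment> \<open>A Lebesgue set is a Borel set up to a null set, which does not change the
      integral.\<close>
    then obtain S N N' where S: "A = S \<union> N" "N \<subseteq> N'" "N' \<in> null_sets lborel" "S \<in> sets lborel"
      by (rule sets_completionE)
    have "AE s in lebesgue. s \<notin> N'" using AE_not_in[OF S(3)] by (rule AE_completion)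
    then have N': "AE s in I01. s \<notin> N'"
      by (auto simp: AE_restrict_space_iff elim: eventually_mono)
    have "set_lebesgue_integral I01 A f = (\<integral>s. indicator S s *\<^sub>R f s \<partial>I01)"
      unfolding set_lebesgue_integral_def
    proof (rule integral_cong_AE)
      show "(\<lambda>s. indicator A s *\<^sub>R f s) \<in> borel_measurable I01" using A by measurable
      show "(\<lambda>s. indicator S s *\<^sub>R f s) \<in> borel_measurable I01"
        using int_ind[of S] S(4) by simp
      show "AE s in I01. indicator A s *\<^sub>R f s = indicator S s *\<^sub>R f s"
        using N' by eventually_elim (use S in \<open>auto split: split_indicator\<close>)
    qed
    then show "set_lebesgue_integral I01 A f = 0" using borel S(4) by simp
  qed
qed

section \<open>The double exponential kernel\<close>

text \<open>The terms of order at least 1 of the series of \<open>1 - exp (- exp (n * (\<tau> - s)))\<close> in powers of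
  \<open>exp (n * (\<tau> - s))\<close> only involve the values \<open>exp_conv (n * k) f 1\<close>, while the kernel itself
  tends to the indicator of \<open>s < \<tau>\<close>.\<close>

lemma norm_double_exp_integral_le:
  fixes f :: "real \<Rightarrow> complex"
  assumes f: "integrable I01 f" and n: "1 \<le> n" and \<tau>: "\<tau> < 1"
    and bound: "\<And>m. n \<le> m \<Longrightarrow> cmod (exp_conv (real m) f 1) \<le> exp (e * real m)"
  shows "cmod (\<integral>s. (1 - exp (- exp (real n * (\<tau> - s)))) *\<^sub>R f s \<partial>I01) \<le> exp (exp (real n * (e - (1 - \<tau>)))) - 1"
proof -
  note measurable_ident_I01 [measurable]
  have [measurable]: "f \<in> borel_measurable I01" using f by simp
  define y where "y s = exp (real n * (\<tau> - s))" for s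
  define c where "c k s = - ((- y s) ^ Suc k / fact (Suc k))" for k s
  define w where "w = exp (real n * (e - (1 - \<tau>)))"
  define T where "T k s = c k s *\<^sub>R f s" for k s
  have [measurable]: "y \<in> borel_measurable I01" unfolding y_def[abs_def] by measurable
  have [measurable]: "c k \<in> borel_measurable I01" for k unfolding c_def[abs_def] by measurable
  have exp_sums: "(\<lambda>k. u ^ Suc k / fact (Suc k)) sums (exp u - 1)" for u :: real
    using exp_converges[of u] sums_Suc_iff[of "\<lambda>k. u ^ k / fact k" "exp u - 1"]
    by (simp add: divide_inverse mult.commute)
  have c_sums: "(\<lambda>k. c k s) sums (1 - exp (- y s))" for s
    using sums_minus[OF exp_sums[of "- y s"]] by (simp add: c_def)
  have abs_c: "\<bar>c k s\<bar> = y s ^ Suc k / fact (Suc k)" for k s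
    by (simp add: c_def y_def power_abs del: power_Suc fact_Suc)
  \<comment> \<open>For fixed n this dominates the series by that of exp (exp n), which allows
    termwise integration.\<close>
  have y_le: "y s \<le> exp (real n)" if "s \<in> space I01" for s
  proof -
    have "real n * (\<tau> - s) \<le> real n * 1" using that \<tau> by (intro mult_left_mono) auto
    then show ?thesis by (simp add: y_def)
  qed
  have T_le: "cmod (T k s) \<le> exp (real n) ^ Suc k / fact (Suc k) * cmod (f s)" if "s \<in> space I01" for k s
    unfolding T_def norm_scaleR abs_c
    using y_le[OF that] by (intro mult_right_mono divide_right_mono power_mono) (auto simp: y_def)
  have T_int: "integrable I01 (T k)" for k
  proof (rule Bochner_Integration.integrable_bound)
    show "integrable I01 (\<lambda>s. exp (real n) ^ Suc k / fact (Suc k) * cmod (f s))" using f by simp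
    show "T k \<in> borel_measurable I01" unfolding T_def[abs_def] by measurable
    show "AE s in I01. norm (T k s) \<le> norm (exp (real n) ^ Suc k / fact (Suc k) * cmod (f s))"
      using T_le by (intro AE_I2) (force simp del: power_Suc fact_Suc)
  qed
  have "(\<lambda>k. integral\<^sup>L I01 (T k)) sums (\<integral>s. (\<Sum>k. T k s) \<partial>I01)"
  proof (rule sums_integral)
    show "integrable I01 (T k)" for k by (rule T_int)
    have "summable (\<lambda>k. cmod (T k s))" for s
      unfolding T_def norm_scaleR abs_c
      using exp_sums[of "y s"] by (intro summable_mult2) (rule sums_summable)
    then show "AE s in I01. summable (\<lambda>k. norm (T k s))" by simp
    have "summable (\<lambda>k. exp (real n) ^ Suc k / fact (Suc k) * (\<integral>s. cmod (f s) \<partial>I01))"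
      using exp_sums[of "exp (real n)"] by (intro summable_mult2) (rule sums_summable)
    then show "summable (\<lambda>k. \<integral>s. norm (T k s) \<partial>I01)"
    proof (rule summable_comparison_test'[where N = 0])
      fix k
      have "(\<integral>s. norm (T k s) \<partial>I01) \<le> (\<integral>s. exp (real n) ^ Suc k / fact (Suc k) * cmod (f s) \<partial>I01)"
        using T_int f T_le by (intro integral_mono) (auto simp del: power_Suc fact_Suc)
      then show "norm (\<integral>s. norm (T k s) \<partial>I01) \<le> exp (real n) ^ Suc k / fact (Suc k) * (\<integral>s. cmod (f s) \<partial>I01)"
        by (simp del: power_Suc fact_Suc)
    qed
  qed
  moreover have "(\<Sum>k. T k s) = (1 - exp (- y s)) *\<^sub>R f s" for s
    unfolding T_def using sums_scaleR_left[OF c_sums] by (rule sums_unique[symmetric])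
  ultimately have J: "(\<lambda>k. integral\<^sup>L I01 (T k)) sums (\<integral>s. (1 - exp (- y s)) *\<^sub>R f s \<partial>I01)"
    by simp
  have term_le: "cmod (integral\<^sup>L I01 (T k)) \<le> w ^ Suc k / fact (Suc k)" for k
  proof -
    define m where "m = n * Suc k"
    \<comment> \<open>The price of replacing \<tau> by 1 in the exponent. Together with the growth
      exp (e m) it gives the power of \<open>w\<close>. The index \<open>Suc k\<close> keeps m >= n,
      so \<open>bound\<close> covers every term.\<close>
    define q where "q = exp (real m * (\<tau> - 1))"
    have "n \<le> m" by (simp add: m_def)
    have ypow: "y s ^ Suc k = q * exp_kernel (real m) 1 s" if "s \<in> space I01" for s
    proof -
      have "y s ^ Suc k = exp (real (Suc k) * (real n * (\<tau> - s)))"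
        unfolding y_def by (rule exp_of_nat_mult[symmetric])
      also have "\<dots> = exp (real m * (\<tau> - 1) + real m * (1 - s))"
        by (simp add: m_def algebra_simps)
      finally show ?thesis using that by (simp add: q_def exp_kernel_def exp_add)
    qed
    have "integral\<^sup>L I01 (T k) =
        (\<integral>s. (- ((- 1) ^ Suc k * q / fact (Suc k))) *\<^sub>R (exp_kernel (real m) 1 s *\<^sub>R f s) \<partial>I01)"
    proof (intro Bochner_Integration.integral_cong refl)
      fix s assume "s \<in> space I01"
      then show "T k s = (- ((- 1) ^ Suc k * q / fact (Suc k))) *\<^sub>R (exp_kernel (real m) 1 s *\<^sub>R f s)"
        unfolding T_def c_def power_minus[of "y s"] using ypow[of s]
        by (simp del: power_Suc fact_Suc add: mult_ac)
    qed
    also have "\<dots> = (- ((- 1) ^ Suc k * q / fact (Suc k))) *\<^sub>R exp_conv (real m) f 1"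
      unfolding exp_conv_def by (rule integral_scaleR_right)
    finally have "cmod (integral\<^sup>L I01 (T k)) = q / fact (Suc k) * cmod (exp_conv (real m) f 1)"
      by (simp add: abs_mult power_abs q_def del: power_Suc fact_Suc)
    also have "\<dots> \<le> q / fact (Suc k) * exp (e * real m)"
      using bound[OF \<open>n \<le> m\<close>] by (intro mult_left_mono) (auto simp: q_def simp del: fact_Suc)
    also have "q * exp (e * real m) = w ^ Suc k"
      unfolding w_def q_def exp_of_nat_mult[symmetric]
      by (simp add: m_def algebra_simps flip: exp_add)
    then have "q / fact (Suc k) * exp (e * real m) = w ^ Suc k / fact (Suc k)"
      by (simp del: power_Suc fact_Suc)
    finally show ?thesis .
  qed
  have "cmod (\<integral>s. (1 - exp (- y s)) *\<^sub>R f s \<partial>I01) = cmod (\<Sum>k. integral\<^sup>L I01 (T k))"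
    using sums_unique[OF J] by simp
  also have "\<dots> \<le> (\<Sum>k. w ^ Suc k / fact (Suc k))"
    using term_le exp_sums[of w] by (intro norm_suminf_le) (auto simp: sums_iff)
  also have "\<dots> = exp w - 1" using exp_sums[of w] by (simp add: sums_iff)
  finally show ?thesis by (simp add: y_def w_def)
qed

text \<open>The double exponential integrals converge to the primitive at \<tau> by dominated
  convergence, and to 0 by the series bound.\<close>

lemma exp_conv_zero_if_subexponential:
  fixes f :: "real \<Rightarrow> complex"
  assumes f: "integrable I01 f" and \<tau>: "\<tau> < 1"
    and bound: "\<And>e. 0 < e \<Longrightarrow> \<forall>\<^sub>F n in sequentially. cmod (exp_conv (real n) f 1) \<le> exp (e * real n)"
  shows "exp_conv 0 f \<tau> = 0"
proof -
  note measurable_ident_I01 [measurable]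
  have [measurable]: "f \<in> borel_measurable I01" using f by simp
  let ?J = "\<lambda>n. \<integral>s. (1 - exp (- exp (real n * (\<tau> - s)))) *\<^sub>R f s \<partial>I01"
  \<comment> \<open>Half of the gap: growth at rate a against decay at rate 1 - \<tau> leaves the
    net rate - a.\<close>
  define a where "a = (1 - \<tau>) / 2"
  have a: "0 < a" using \<tau> by (simp add: a_def)
  have "?J \<longlonglongrightarrow> exp_conv 0 f \<tau>"
    unfolding exp_conv_def
  proof (rule integral_dominated_convergence)
    show "integrable I01 (\<lambda>s. cmod (f s))" using f by simp
    show "(\<lambda>s. exp_kernel 0 \<tau> s *\<^sub>R f s) \<in> borel_measurable I01" by measurable
    show "(\<lambda>s. (1 - exp (- exp (real n * (\<tau> - s)))) *\<^sub>R f s) \<in> borel_measurable I01" for n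
      by measurable
    show "AE s in I01. norm ((1 - exp (- exp (real n * (\<tau> - s)))) *\<^sub>R f s) \<le> cmod (f s)" for n
      by (intro AE_I2) (auto intro!: mult_left_le_one_le)
    show "AE s in I01. (\<lambda>n. (1 - exp (- exp (real n * (\<tau> - s)))) *\<^sub>R f s) \<longlonglongrightarrow> exp_kernel 0 \<tau> s *\<^sub>R f s"
      \<comment> \<open>At s = \<tau> the kernel stays at 1 - exp (-1) instead of tending to 1, so
        this point is discarded.\<close>
      using AE_I01_neq[of \<tau>]
    proof eventually_elim
      case (elim s)
      have "(\<lambda>n. 1 - exp (- exp (real n * (\<tau> - s)))) \<longlonglongrightarrow> exp_kernel 0 \<tau> s"
      proof (cases "s < \<tau>")
        case True
        then have "0 < \<tau> - s" by simp
        then have "(\<lambda>n. 1 - exp (- exp (real n * (\<tau> - s)))) \<longlonglongrightarrow> 1" by real_asymp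
        then show ?thesis using True by (simp add: exp_kernel_def)
      next
        case False
        then have "\<tau> - s < 0" using elim by simp
        then have "(\<lambda>n. 1 - exp (- exp (real n * (\<tau> - s)))) \<longlonglongrightarrow> 0" by real_asymp
        then show ?thesis using False elim by (simp add: exp_kernel_def)
      qed
      then show ?case by (intro tendsto_scaleR tendsto_const)
    qed
  qed
  moreover have "?J \<longlonglongrightarrow> 0"
  proof (rule Lim_null_comparison)
    obtain N where N: "\<And>m. N \<le> m \<Longrightarrow> cmod (exp_conv (real m) f 1) \<le> exp (a * real m)"
      using bound[OF a] by (auto simp: eventually_sequentially)
    show "\<forall>\<^sub>F n in sequentially. norm (?J n) \<le> exp (exp (real n * (- a))) - 1"
      using eventually_ge_at_top[of "max N 1"]
    proof eventually_elim
      case (elim n)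
      have "cmod (?J n) \<le> exp (exp (real n * (a - (1 - \<tau>)))) - 1"
        using elim N by (intro norm_double_exp_integral_le f \<tau>) auto
      moreover have "a - (1 - \<tau>) = - a" by (simp add: a_def field_simps)
      ultimately show ?case by simp
    qed
    show "(\<lambda>n. exp (exp (real n * (- a))) - 1) \<longlonglongrightarrow> 0" using a by real_asymp
  qed
  ultimately show ?thesis by (rule LIMSEQ_unique)
qed

theorem theorem4p12:
  fixes f :: "real \<Rightarrow> complex"
  assumes "L2 f" and "L2norm f \<noteq> 0"
  shows "k_vol f > 0"
proof (rule ccontr)
  assume "\<not> k_vol f > 0"
  then have k: "k_vol f \<le> 0" by simp
  have f: "integrable I01 f" by (rule L2_integrable[OF assms(1)])
  have "exp_conv 0 f t = 0" if "t < 1" for t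
    using eventually_norm_exp_conv_le[OF assms(1) k]
    by (intro exp_conv_zero_if_subexponential f that)
  then have "AE s in I01. f s = 0" by (rule AE_zero_if_exp_conv_zero[OF f])
  then have "L2norm f = L2norm (\<lambda>_. 0)"
    using f by (intro L2norm_cong_AE) auto
  then show False using assms(2) by (simp add: L2norm_def)
qed

end
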